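(* Let $A_1$, $A_2$ be finite-dimensional complex vector spaces with $\mathbb{C}$-bases $(e_{1\cdot i})_i$, $(e_{2\cdot j})_j$ and associated real bases. Let $f:A_1\to A_2$ be a $\mathbb{C}$-linear mapping with real matrix $(f^{qj}_{pi})$, $p,q\in\{0,1\}$, with respect to the associated real bases, i.e. for $x_2=f(x_1)$, $x_2^{qj}=\sum_{p,i} f^{qj}_{pi}x_1^{pi}$. Then, for every $x_1\in A_1$ and $x_2=f(x_1)$, with respect to the real bases the mapping has the form $$x_2^{0j}=\sum_i\left(f^{0j}_{0i}x_1^{0i}-f^{1j}_{0i}x_1^{1i}\right),\qquad x_2^{1j}=\sum_i\left(f^{1j}_{0i}x_1^{0i}+f^{0j}_{0i}x_1^{1i}\right),$$ and with respect to the complex bases it has the form $$x_2^j=\sum_i f^j_i x_1^i,\qquad f^j_i=f^{0j}_{0i}+f^{1j}_{0i}\,\mathrm{i}.$$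
   Context: For a complex vector space $A$ with $\mathbb{C}$-basis $(e_i)$, the associated real basis consists of the vectors $e_{0i}=e_i$ and $e_{1i}=\mathrm{i}\,e_i$ ($\mathrm{i}$ the imaginary unit). The complex coordinates $x^i\in\mathbb{C}$ and real coordinates $x^{0i},x^{1i}\in\mathbb{R}$ of $x\in A$ are defined by $x=\sum_i x^i e_i$, $x^i=x^{0i}+x^{1i}\mathrm{i}$. A mapping $f$ is $\mathbb{C}$-linear if it is additive (real linear) and $f(ca)=cf(a)$ for all $c\in\mathbb{C}$, $a\in A_1$. *)

theory Defs
  imports "HOL-Analysis.Analysis"
begin

definition is_basis :: "('k::field \<Rightarrow> 'a::ab_group_add \<Rightarrow> 'a) \<Rightarrow> 'i set \<Rightarrow> ('i \<Rightarrow> 'a) \<Rightarrow> bool" where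
  "is_basis s I e \<longleftrightarrow> finite I \<and> inj_on e I \<and>
     \<not> module.dependent s (e ` I) \<and> module.span s (e ` I) = UNIV"

definition coord :: "('k::field \<Rightarrow> 'a::ab_group_add \<Rightarrow> 'a) \<Rightarrow> 'i set \<Rightarrow> ('i \<Rightarrow> 'a) \<Rightarrow> 'i \<Rightarrow> 'a \<Rightarrow> 'k" where
  "coord s I e i x = module.representation s (e ` I) x (e i)"

definition real_scale :: "(complex \<Rightarrow> 'a \<Rightarrow> 'a) \<Rightarrow> real \<Rightarrow> 'a \<Rightarrow> 'a" where
  "real_scale s r x = s (complex_of_real r) x"

(* The index p ranges over {0, 1}: e_0i = e_i and e_1i = i e_i. *)
definition real_basis :: "(complex \<Rightarrow> 'a \<Rightarrow> 'a) \<Rightarrow> ('i \<Rightarrow> 'a) \<Rightarrow> nat \<times> 'i \<Rightarrow> 'a" where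
  "real_basis s e = (\<lambda>(p, i). if p = 0 then e i else s \<i> (e i))"

(* x^0i and x^1i are given by x^i = x^0i + x^1i i; real_coord_eq_coord below shows that
   they are the coordinates of x in the associated real basis. *)
definition real_coord ::
    "(complex \<Rightarrow> 'a::ab_group_add \<Rightarrow> 'a) \<Rightarrow> 'i set \<Rightarrow> ('i \<Rightarrow> 'a) \<Rightarrow> nat \<Rightarrow> 'i \<Rightarrow> 'a \<Rightarrow> real" where
  "real_coord s I e p i x = (if p = 0 then Re (coord s I e i x) else Im (coord s I e i x))"

(* F q j p i is the entry with upper index qj and lower index pi. *)
definition is_real_matrix ::
    "(complex \<Rightarrow> 'a::ab_group_add \<Rightarrow> 'a) \<Rightarrow> 'i set \<Rightarrow> ('i \<Rightarrow> 'a) \<Rightarrow>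
     (complex \<Rightarrow> 'b::ab_group_add \<Rightarrow> 'b) \<Rightarrow> 'j set \<Rightarrow> ('j \<Rightarrow> 'b) \<Rightarrow>
     ('a \<Rightarrow> 'b) \<Rightarrow> (nat \<Rightarrow> 'j \<Rightarrow> nat \<Rightarrow> 'i \<Rightarrow> real) \<Rightarrow> bool" where
  "is_real_matrix s1 I e1 s2 J e2 f F \<longleftrightarrow>
     (\<forall>x. \<forall>q\<in>{0, 1}. \<forall>j\<in>J. real_coord s2 J e2 q j (f x) =
        (\<Sum>p\<in>{0, 1}. \<Sum>i\<in>I. F q j p i * real_coord s1 I e1 p i x))"

lemma coord_expansion:
  assumes "vector_space s" "is_basis s I e"
  shows "(\<Sum>i\<in>I. s (coord s I e i x) (e i)) = x"
proof -
  interpret vector_space s by fact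
  have "(\<Sum>b\<in>e ` I. s (representation (e ` I) x b) b) = x"
    using assms(2) by (intro sum_representation_eq) (auto simp: is_basis_def)
  then show ?thesis
    using assms(2) by (simp add: is_basis_def sum.reindex coord_def)
qed

lemma coord_eqI:
  assumes "vector_space s" "is_basis s I e" "(\<Sum>i\<in>I. s (c i) (e i)) = x" "i \<in> I"
  shows "coord s I e i x = c i"
proof -
  interpret vector_space s by fact
  have fin: "finite I" and inj: "inj_on e I" and ind: "independent (e ` I)"
    and sp: "span (e ` I) = UNIV"
    using assms(2) by (auto simp: is_basis_def)
  let ?g = "\<lambda>b. if b \<in> e ` I then c (the_inv_into I e b) else 0"
  have "representation (e ` I) x = ?g"
  proof (rule representation_eqI[OF ind])
    have sub: "{b. ?g b \<noteq> 0} \<subseteq> e ` I" by (auto split: if_splits)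
    show "finite {b. ?g b \<noteq> 0}"
      using finite_subset[OF sub] fin by blast
    have "(\<Sum>b | ?g b \<noteq> 0. s (?g b) b) = (\<Sum>b\<in>e ` I. s (?g b) b)"
      using sub fin by (intro sum.mono_neutral_left) auto
    also have "\<dots> = (\<Sum>i\<in>I. s (c i) (e i))"
      using inj by (simp add: sum.reindex the_inv_into_f_f)
    finally show "(\<Sum>b | ?g b \<noteq> 0. s (?g b) b) = x" using assms(3) by simp
  qed (use sp in \<open>auto split: if_splits\<close>)
  then show ?thesis
    using inj assms(4) by (simp add: coord_def the_inv_into_f_f)
qed

lemma vector_space_real_scale:
  assumes "vector_space s"
  shows "vector_space (real_scale s)"
proof -
  interpret vector_space s by fact
  show ?thesis
    by unfold_locales (auto simp: real_scale_def scale_left_distrib scale_right_distrib)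
qed

lemma real_basis_sum:
  assumes "vector_space s" "finite I"
  shows "(\<Sum>k\<in>{0, 1} \<times> I. real_scale s (r k) (real_basis s e k)) =
    (\<Sum>i\<in>I. s (Complex (r (0, i)) (r (1, i))) (e i))"
proof -
  interpret vector_space s by fact
  have "(\<Sum>k\<in>{0, 1} \<times> I. real_scale s (r k) (real_basis s e k)) =
      (\<Sum>p\<in>{0, 1}. \<Sum>i\<in>I. real_scale s (r (p, i)) (real_basis s e (p, i)))"
    by (simp add: sum.cartesian_product)
  also have "\<dots> = (\<Sum>i\<in>I. s (Complex (r (0, i)) (r (1, i))) (e i))"
    by (simp add: real_scale_def real_basis_def sum.distrib[symmetric]
        scale_left_distrib[symmetric] Complex_eq mult.commute)
  finally show ?thesis .
qed

lemma is_basis_real_basis: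
  assumes vs: "vector_space s" and B: "is_basis s I e"
  shows "is_basis (real_scale s) ({0, 1} \<times> I) (real_basis s e)"
proof -
  interpret vector_space s by fact
  interpret R: vector_space "real_scale s" by (rule vector_space_real_scale[OF vs])
  have fin: "finite I" using B by (simp add: is_basis_def)
  let ?K = "{0::nat, 1} \<times> I" and ?b = "real_basis s e"
  have zero: "r k = 0" if "(\<Sum>k\<in>?K. real_scale s (r k) (?b k)) = 0" "k \<in> ?K" for r k
  proof -
    have *: "(\<Sum>i\<in>I. s (Complex (r (0, i)) (r (1, i))) (e i)) = 0"
      using that(1) real_basis_sum[OF vs fin] by simp
    have "Complex (r (0, i)) (r (1, i)) = 0" if "i \<in> I" for i
      using coord_eqI[OF vs B * that] coord_eqI[OF vs B, of "\<lambda>_. 0" 0 i] that by simp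
    then show ?thesis using that(2) by (auto simp: complex_eq_iff)
  qed
  have inj: "inj_on ?b ?K"
  proof (rule inj_onI, rule ccontr)
    fix k l assume kl: "k \<in> ?K" "l \<in> ?K" "?b k = ?b l" "k \<noteq> l"
    let ?r = "\<lambda>m. if m = k then 1 else if m = l then - 1 else (0::real)"
    have "(\<Sum>m\<in>?K. real_scale s (?r m) (?b m)) = (\<Sum>m\<in>{k, l}. real_scale s (?r m) (?b m))"
      using kl fin by (intro sum.mono_neutral_right) auto
    also have "\<dots> = 0" using kl by simp
    finally show False using zero[of ?r k] kl by simp
  qed
  have "\<not> R.dependent (?b ` ?K)"
  proof
    assume "R.dependent (?b ` ?K)"
    then obtain u v where u: "v \<in> ?b ` ?K" "u v \<noteq> 0" "(\<Sum>v\<in>?b ` ?K. real_scale s (u v) v) = 0"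
      using R.dependent_finite[of "?b ` ?K"] fin by blast
    have "(\<Sum>k\<in>?K. real_scale s (u (?b k)) (?b k)) = 0"
      using u(3) sum.reindex[OF inj, of "\<lambda>v. real_scale s (u v) v"] by simp
    then show False using zero[of "\<lambda>k. u (?b k)"] u by blast
  qed
  moreover have "x \<in> R.span (?b ` ?K)" for x
  proof -
    let ?r = "\<lambda>(p::nat, i). if p = 0 then Re (coord s I e i x) else Im (coord s I e i x)"
    have "x = (\<Sum>k\<in>?K. real_scale s (?r k) (?b k))"
      unfolding real_basis_sum[OF vs fin] using coord_expansion[OF vs B, of x] by simp
    also have "\<dots> \<in> R.span (?b ` ?K)"
      by (intro R.span_sum R.span_scale R.span_base) auto
    finally show ?thesis .
  qed
  ultimately show ?thesis using inj fin unfolding is_basis_def by auto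
qed

lemma real_coord_eq_coord:
  assumes vs: "vector_space s" and B: "is_basis s I e" and "p \<in> {0, 1}" "i \<in> I"
  shows "real_coord s I e p i x = coord (real_scale s) ({0, 1} \<times> I) (real_basis s e) (p, i) x"
proof -
  have fin: "finite I" using B by (simp add: is_basis_def)
  have "(\<Sum>k\<in>{0::nat, 1} \<times> I. real_scale s (case k of (p, i) \<Rightarrow> real_coord s I e p i x)
      (real_basis s e k)) = x"
    unfolding real_basis_sum[OF vs fin] using coord_expansion[OF vs B, of x]
    by (simp add: real_coord_def)
  from coord_eqI[OF vector_space_real_scale[OF vs] is_basis_real_basis[OF vs B] this, of "(p, i)"]
  show ?thesis using assms(3,4) by simp
qed

end

theory Submission
  imports Defs
begin

text \<open>Evaluating the real matrix at a basis vector shows that the complex coordinates of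
  \<open>f (e\<^sub>i)\<close> are \<open>f\<^sup>0\<^sup>j\<^sub>0\<^sub>i + f\<^sup>1\<^sup>j\<^sub>0\<^sub>i \<i>\<close>. Complex linearity turns this into the complex form of
  the mapping, whose real and imaginary parts are the two real formulas.\<close>

text \<open>For an independent spanning set, \<open>representation\<close> is linear in the vector.
  This lets a coordinate be read off after \<open>f\<close> has been moved inside a basis
  expansion.\<close>

lemma coord_sum_scale:
  assumes "vector_space s" "is_basis s I e" "i \<in> I"
  shows "coord s I e i (\<Sum>k\<in>K. s (c k) (v k)) = (\<Sum>k\<in>K. c k * coord s I e i (v k))"
proof -
  interpret vector_space s by fact
  have "independent (e ` I)" "span (e ` I) = UNIV"
    using assms(2) by (auto simp: is_basis_def)
  then show ?thesis
    by (simp add: coord_def representation_sum representation_scale)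
qed

lemma coord_basis:
  assumes "vector_space s" "is_basis s I e" "i \<in> I" "k \<in> I"
  shows "coord s I e k (e i) = (if k = i then 1 else 0)"
proof -
  interpret vector_space s by fact
  have "inj_on e I" "independent (e ` I)"
    using assms(2) by (auto simp: is_basis_def)
  then show ?thesis
    using assms(3,4) by (auto simp: coord_def representation_basis inj_on_eq_iff)
qed

text \<open>Expand \<open>x\<close> in the basis \<open>e1\<close>, move \<open>f\<close> inside the
  sum by complex linearity and take the coordinate at \<open>j\<close>: column \<open>i\<close> of
  the complex matrix consists of the coordinates of \<open>f (e1 i)\<close>.\<close>

lemma coord_linear:
  assumes "vector_space s1" "vector_space s2" "is_basis s1 I e1" "is_basis s2 J e2"
    and "Vector_Spaces.linear s1 s2 f" "j \<in> J"
  shows "coord s2 J e2 j (f x) = (\<Sum>i\<in>I. coord s2 J e2 j (f (e1 i)) * coord s1 I e1 i x)"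
proof -
  interpret Vector_Spaces.linear s1 s2 f by fact
  have "f x = f (\<Sum>i\<in>I. s1 (coord s1 I e1 i x) (e1 i))"
    using coord_expansion[OF assms(1,3)] by simp
  also have "\<dots> = (\<Sum>i\<in>I. s2 (coord s1 I e1 i x) (f (e1 i)))"
    by (simp add: sum scale)
  finally show ?thesis
    using coord_sum_scale[OF assms(2,4,6)] by (simp add: mult.commute)
qed

text \<open>The vector \<open>e1 i\<close> is itself the real basis vector with index
  \<open>(0, i)\<close>, so the real matrix applied to it returns its column \<open>(0, i)\<close>;
  the rows \<open>q = 0\<close> and \<open>q = 1\<close> are the real and imaginary parts
  sought.\<close>

lemma coord_image_basis:
  assumes "vector_space s1" "is_basis s1 I e1" "is_real_matrix s1 I e1 s2 J e2 f F"
    and "i \<in> I" "j \<in> J"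
  shows "coord s2 J e2 j (f (e1 i)) = Complex (F 0 j 0 i) (F 1 j 0 i)"
proof -
  have fin: "finite I" using assms(2) by (simp add: is_basis_def)
  have "real_coord s2 J e2 q j (f (e1 i)) = F q j 0 i" if "q \<in> {0, 1}" for q
  proof -
    have "real_coord s2 J e2 q j (f (e1 i)) =
        (\<Sum>p\<in>{0, 1}. \<Sum>k\<in>I. F q j p k * real_coord s1 I e1 p k (e1 i))"
      using assms(3,5) that unfolding is_real_matrix_def by blast
    \<comment> \<open>The complex coordinates of \<open>e1 i\<close> are 0 and 1, both real, so only
      \<open>p = 0\<close>, \<open>k = i\<close> contributes. The test on \<open>k\<close> is
      outermost so that the sum over \<open>k\<close> collapses.\<close>
    also have "\<dots> = (\<Sum>p\<in>{0, 1}. \<Sum>k\<in>I. if k = i then if p = 0 then F q j p k else 0 else 0)"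
      by (intro sum.cong refl)
        (auto simp: real_coord_def coord_basis[OF assms(1,2,4)])
    also have "\<dots> = F q j 0 i"
      using fin assms(4) by simp
    finally show ?thesis .
  qed
  from this[of 0] this[of 1] show ?thesis
    by (simp add: real_coord_def complex_eq_iff)
qed

theorem theorem4p3:
  fixes s1 :: "complex \<Rightarrow> 'a::ab_group_add \<Rightarrow> 'a"
    and s2 :: "complex \<Rightarrow> 'b::ab_group_add \<Rightarrow> 'b"
    and I :: "'i set" and J :: "'j set"
    and e1 :: "'i \<Rightarrow> 'a" and e2 :: "'j \<Rightarrow> 'b"
    and f :: "'a \<Rightarrow> 'b"
    and F :: "nat \<Rightarrow> 'j \<Rightarrow> nat \<Rightarrow> 'i \<Rightarrow> real"
  assumes "vector_space s1" and "vector_space s2"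
    and "is_basis s1 I e1" and "is_basis s2 J e2"
    and "Vector_Spaces.linear s1 s2 f"
    and "is_real_matrix s1 I e1 s2 J e2 f F"
  shows "\<forall>x1 x2. x2 = f x1 \<longrightarrow> (\<forall>j\<in>J.
      real_coord s2 J e2 0 j x2 =
        (\<Sum>i\<in>I. F 0 j 0 i * real_coord s1 I e1 0 i x1 - F 1 j 0 i * real_coord s1 I e1 1 i x1) \<and>
      real_coord s2 J e2 1 j x2 =
        (\<Sum>i\<in>I. F 1 j 0 i * real_coord s1 I e1 0 i x1 + F 0 j 0 i * real_coord s1 I e1 1 i x1) \<and>
      coord s2 J e2 j x2 =
        (\<Sum>i\<in>I. (complex_of_real (F 0 j 0 i) + complex_of_real (F 1 j 0 i) * \<i>)
                * coord s1 I e1 i x1))"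
proof (intro allI impI ballI)
  fix x1 x2 j
  assume x2: "x2 = f x1" and j: "j \<in> J"
  have c: "coord s2 J e2 j x2 = (\<Sum>i\<in>I. Complex (F 0 j 0 i) (F 1 j 0 i) * coord s1 I e1 i x1)"
    using coord_linear[OF assms(1-5) j, of x1]
    by (simp add: x2 coord_image_basis[OF assms(1,3,6) _ j])
  show "real_coord s2 J e2 0 j x2 =
        (\<Sum>i\<in>I. F 0 j 0 i * real_coord s1 I e1 0 i x1 - F 1 j 0 i * real_coord s1 I e1 1 i x1) \<and>
      real_coord s2 J e2 1 j x2 =
        (\<Sum>i\<in>I. F 1 j 0 i * real_coord s1 I e1 0 i x1 + F 0 j 0 i * real_coord s1 I e1 1 i x1) \<and>
      coord s2 J e2 j x2 =
        (\<Sum>i\<in>I. (complex_of_real (F 0 j 0 i) + complex_of_real (F 1 j 0 i) * \<i>)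
                * coord s1 I e1 i x1)"
    \<comment> \<open>Taking \<open>Re\<close> and \<open>Im\<close> of each product in
      \<open>c\<close> gives the two real formulas; the minus sign comes from \<i> squared being -1.
      The third conjunct is \<open>c\<close> with \<open>Complex\<close> written out.\<close>
    by (simp add: real_coord_def c Complex_eq mult.commute add.commute)
qed

end
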